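(* Let $d \ge 1$ be an integer, let $c \in \mathbb{R}^d$ and $r > 0$, and let $B(c,r)$ be the open ball in $\mathbb{R}^d$ with center $c$ and radius $r$. Let $\theta \in B(c,r)$ and let $Y$ be a random vector taking values in $\partial B(c,r)$, distributed according to the harmonic measure on $\partial B(c,r)$ parametrized by $\theta$, i.e. $Y \sim \mathcal{H}_\theta^{B(c,r)}$. Then the covariance matrix $\Sigma_Y$ of $Y$ satisfies $$\operatorname{tr}(\Sigma_Y) = r^2 - \|\theta - c\|^2.$$
   Context: $\|\cdot\|$ is the Euclidean norm on $\mathbb{R}^d$, and $\operatorname{tr}$ denotes the trace. The covariance matrix of a random vector $Y = (Y_1,\dots,Y_d)$ is $\Sigma_Y = \big(\operatorname{Cov}(Y_i,Y_j)\big)_{1 \le i,j \le d}$. Harmonic measure: for a domain (open connected set) $D$ in $\mathbb{R}^d$, a Borel measurable set $E \subseteq \partial D$ and $x \in D$, $\omega(x,E,D)$ denotes the value at $x$ of the harmonic extension into $D$ of the boundary data $\mathbf{1}_E$. As a function of $x$ it is harmonic in $D$, and for fixed $x$ it is a measure in $E$. When $D$ is bounded and regular (every boundary point $z$ satisfies $\mathbb{P}\{\tau_D = 0 \mid X_0 = z\} = 1$, with $X$ and $\tau_D$ as below), as is the case for a ball, by Kakutani's theorem this is equivalently the exit distribution of Brownian motion: $$\omega(x,E,D) = \mathbb{P}\{X_{\tau_D} \in E \mid X_0 = x\},$$ where $\{X_t\}_{t\ge 0}$ is a standard Brownian motion in $\mathbb{R}^d$ and $\tau_D = \inf\{t>0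 : X_t \notin D\}$ is its exit time from $D$. For $\theta \in D$, the notation $Y \sim \mathcal{H}_\theta^D$ means that $Y$ is a random vector on $\partial D$ with $\mathbb{P}\{Y \in E\} = \omega(\theta,E,D)$ for every Borel measurable $E \subseteq \partial D$; equivalently (for $D$ bounded and regular), $Y$ has the same distribution as the exit point $X_{\tau_D}$ from $D$ of a Brownian motion started at $\theta$. *)

theory Defs
  imports "HOL-Probability.Probability"
begin

text \<open>
  Harmonic extensions are taken in the sense of Perron, Wiener and Brelot, which is what gives
  a meaning to the harmonic extension of a discontinuous boundary function such as the
  indicator of an arbitrary Borel set \<open>E \<subseteq> frontier D\<close>.
\<close>

text \<open>
  Lower semicontinuity and the super-mean-value property over closed balls contained in the
  open set \<open>D\<close>. The values of \<open>u\<close> outside \<open>D\<close> are irrelevant. Integrability is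
  required explicitly because the Bochner integral of a non-integrable function is \<open>0\<close>.
  Finite values suffice here: boundary data \<open>f \<le> K\<close> with \<open>K \<ge> 0\<close> allow replacing an
  upper function \<open>u\<close> with values in \<open>(-\<infinity>, \<infinity>]\<close> by \<open>min u K\<close>.
\<close>

definition superharmonic_on :: "'a::euclidean_space set \<Rightarrow> ('a \<Rightarrow> real) \<Rightarrow> bool" where
  "superharmonic_on D u \<longleftrightarrow>
     (\<forall>a. open {x \<in> D. a < u x}) \<and>
     (\<forall>x s. 0 < s \<and> cball x s \<subseteq> D \<longrightarrow>
        set_integrable lborel (cball x s) u \<and>
        (LINT y:cball x s|lborel. u y) / measure lborel (cball x s) \<le> u x)"

text \<open>
  The last condition gives the point at infinity the boundary value \<open>0\<close>; it holds
  trivially when \<open>D\<close> is bounded.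
\<close>

definition perron_upper_class ::
    "'a::euclidean_space set \<Rightarrow> ('a \<Rightarrow> real) \<Rightarrow> ('a \<Rightarrow> real) set" where
  "perron_upper_class D f =
     {u. superharmonic_on D u \<and>
         (\<forall>z \<in> frontier D. ereal (f z) \<le> Liminf (at z within D) (\<lambda>x. ereal (u x))) \<and>
         0 \<le> Liminf (inf at_infinity (principal D)) (\<lambda>x. ereal (u x))}"

text \<open>
  The upper Perron solution. For bounded \<open>D\<close> and bounded Borel data it is harmonic in \<open>D\<close>
  and equals the lower solution \<open>- harmonic_extension D (\<lambda>z. - f z) x\<close>, since such data
  are resolutive.
\<close>

definition harmonic_extension ::
    "'a::euclidean_space set \<Rightarrow> ('a \<Rightarrow> real) \<Rightarrow> 'a \<Rightarrow> real" where
  "harmonic_extension D f x = (INF u \<in> perron_upper_class D f. u x)"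

definition harmonic_measure ::
    "'a::euclidean_space \<Rightarrow> 'a set \<Rightarrow> 'a set \<Rightarrow> real" where
  "harmonic_measure x E D = harmonic_extension D (indicat_real E) x"

definition harmonic_distributed ::
    "'w measure \<Rightarrow> ('w \<Rightarrow> 'a::euclidean_space) \<Rightarrow> 'a \<Rightarrow> 'a set \<Rightarrow> bool" where
  "harmonic_distributed M Y \<theta> D \<longleftrightarrow>
     Y \<in> borel_measurable M \<and>
     (\<forall>w \<in> space M. Y w \<in> frontier D) \<and>
     (\<forall>E \<in> sets borel. E \<subseteq> frontier D \<longrightarrow>
        measure M {w \<in> space M. Y w \<in> E} = harmonic_measure \<theta> E D)"

definition covariance :: "'w measure \<Rightarrow> ('w \<Rightarrow> real) \<Rightarrow> ('w \<Rightarrow> real) \<Rightarrow> real" where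
  "covariance M U V =
     (\<integral>w. (U w - (\<integral>w'. U w' \<partial>M)) * (V w - (\<integral>w'. V w' \<partial>M)) \<partial>M)"

definition covariance_matrix ::
    "'w measure \<Rightarrow> ('w \<Rightarrow> real ^ 'n) \<Rightarrow> real ^ 'n ^ 'n" where
  "covariance_matrix M Y = (\<chi> i j. covariance M (\<lambda>w. Y w $ i) (\<lambda>w. Y w $ j))"

end

theory Submission
  imports Defs
begin

text \<open>
  Since \<open>Y\<close> lies on the sphere, \<open>E \<parallel>Y - c\<parallel>\<^sup>2 = r\<^sup>2\<close>, and the trace of the covariance matrix is
  \<open>E \<parallel>Y - c\<parallel>\<^sup>2 - \<parallel>E Y - c\<parallel>\<^sup>2\<close>. So everything rests on \<open>E Y = \<theta>\<close>, which holds because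
  coordinates are harmonic functions
  (\<open>harmonic_distributed_expectation_inner\<close>, valid for every bounded open set).

  The equation \<open>E Y = \<theta>\<close> comes from the definition of harmonic measure as an upper Perron
  solution, by comparison with upper functions. Let \<open>h\<close> be subharmonic,
  continuous up to the frontier and dominated there by a step function
  \<open>\<Sum> a\<^sub>i 1[E\<^sub>i]\<close> with \<open>a\<^sub>i \<ge> 0\<close>. If \<open>v\<^sub>i\<close> is an upper function for \<open>1[E\<^sub>i]\<close>, then
  \<open>\<Sum> a\<^sub>i v\<^sub>i - h\<close> is superharmonic with non-negative boundary values, hence non-negative by the
  minimum principle. Taking infima over the \<open>v\<^sub>i\<close> gives
  \<open>h \<theta> \<le> \<Sum> a\<^sub>i \<omega>(\<theta>, E\<^sub>i, D)\<close> (\<open>subharmonic_le_sum_harmonic_measure\<close>).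
  The right-hand side is the expectation of the step function at \<open>Y\<close>, and approximating a
  non-negative \<open>h\<close> from above by step functions yields \<open>h \<theta> \<le> E h(Y)\<close>
  (\<open>subharmonic_le_expectation\<close>). This is only an inequality, but as the law of \<open>Y\<close> is a
  probability measure it may be applied to both \<open>K + x \<bullet> e\<close> and \<open>K - x \<bullet> e\<close> for a large
  constant \<open>K\<close>, which forces \<open>E (Y \<bullet> e) = \<theta> \<bullet> e\<close>.
\<close>

section \<open>Superharmonic functions\<close>

lemma superharmonic_onD_lsc: "superharmonic_on D u \<Longrightarrow> open {x \<in> D. a < u x}"
  by (simp add: superharmonic_on_def)

lemma superharmonic_onD_mean:
  assumes "superharmonic_on D u" "0 < s" "cball x s \<subseteq> D"
  shows "set_integrable lborel (cball x s) u"
    and "(LINT y:cball x s|lborel. u y) \<le> measure lborel (cball x s) * u x"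
proof -
  have "measure lborel (cball x s) > 0"
    using content_cball_pos[OF \<open>0 < s\<close>] by simp
  then show "(LINT y:cball x s|lborel. u y) \<le> measure lborel (cball x s) * u x"
    using assms unfolding superharmonic_on_def by (simp add: field_simps)
qed (use assms in \<open>simp add: superharmonic_on_def\<close>)

lemma superharmonic_onI:
  assumes "\<And>a. open {x \<in> D. a < u x}"
    and "\<And>x s. 0 < s \<Longrightarrow> cball x s \<subseteq> D \<Longrightarrow> set_integrable lborel (cball x s) u"
    and "\<And>x s. 0 < s \<Longrightarrow> cball x s \<subseteq> D \<Longrightarrow>
      (LINT y:cball x s|lborel. u y) \<le> measure lborel (cball x s) * u x"
  shows "superharmonic_on D u"
proof -
  have "measure lborel (cball x s) > 0" if "0 < s" for x :: 'a and s
    using content_cball_pos[OF that] by simp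
  then show ?thesis
    using assms unfolding superharmonic_on_def by (simp add: field_simps)
qed

lemma superharmonic_on_add:
  assumes u: "superharmonic_on D u" and v: "superharmonic_on D v"
  shows "superharmonic_on D (\<lambda>x. u x + v x)"
proof (rule superharmonic_onI)
  fix a
  have "{x \<in> D. a < u x + v x} = (\<Union>b. {x \<in> D. b < u x} \<inter> {x \<in> D. a - b < v x})"
  proof (intro equalityI subsetI)
    fix x assume x: "x \<in> {x \<in> D. a < u x + v x}"
    then have "a - v x < u x" by auto
    then obtain b where "a - v x < b" "b < u x" using dense by blast
    with x show "x \<in> (\<Union>b. {x \<in> D. b < u x} \<inter> {x \<in> D. a - b < v x})"
      by (intro UN_I[of b]) auto
  qed auto
  then show "open {x \<in> D. a < u x + v x}"
    using superharmonic_onD_lsc[OF u] superharmonic_onD_lsc[OF v] by (auto intro!: open_UN)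
next
  fix x s assume s: "0 < (s::real)" "cball x s \<subseteq> D"
  note mean = superharmonic_onD_mean[OF u s] superharmonic_onD_mean[OF v s]
  then show "set_integrable lborel (cball x s) (\<lambda>x. u x + v x)"
    by (intro set_integral_add)
  show "(LINT y:cball x s|lborel. u y + v y) \<le> measure lborel (cball x s) * (u x + v x)"
    using mean by (subst set_integral_add) (auto simp: distrib_left)
qed

lemma superharmonic_on_const: "open D \<Longrightarrow> superharmonic_on D (\<lambda>_. k)"
proof (rule superharmonic_onI)
  fix a assume "open D"
  then show "open {x \<in> D. a < k}" by (cases "a < k") auto
next
  fix x s show "set_integrable lborel (cball x s) (\<lambda>_. k)"
    unfolding set_integrable_def using emeasure_compact_finite[OF compact_cball]
    by (intro integrable_scaleR_left integrable_real_indicator) auto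
qed (auto simp: set_lebesgue_integral_def)

lemma superharmonic_on_cmult:
  assumes u: "superharmonic_on D u" and "open D" "0 \<le> k"
  shows "superharmonic_on D (\<lambda>x. k * u x)"
proof (cases "k = 0")
  case True
  then show ?thesis using superharmonic_on_const[OF \<open>open D\<close>, of 0] by simp
next
  case False
  with \<open>0 \<le> k\<close> have "0 < k" by simp
  show ?thesis
  proof (rule superharmonic_onI)
    fix a
    have "{x \<in> D. a < k * u x} = {x \<in> D. a / k < u x}"
      using \<open>0 < k\<close> by (auto simp: field_simps)
    then show "open {x \<in> D. a < k * u x}"
      using superharmonic_onD_lsc[OF u] by simp
  next
    fix x s assume s: "0 < (s::real)" "cball x s \<subseteq> D"
    note mean = superharmonic_onD_mean[OF u s]
    then show "set_integrable lborel (cball x s) (\<lambda>x. k * u x)" by simp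
    show "(LINT y:cball x s|lborel. k * u y) \<le> measure lborel (cball x s) * (k * u x)"
      using mult_left_mono[OF mean(2) \<open>0 \<le> k\<close>] by (simp add: mult_ac)
  qed
qed

lemma superharmonic_on_sum:
  assumes "open D" and "\<And>i. i \<in> I \<Longrightarrow> superharmonic_on D (u i)"
  shows "superharmonic_on D (\<lambda>x. \<Sum>i\<in>I. u i x)"
  using assms(2)
  by (induction I rule: infinite_finite_induct)
    (auto simp: superharmonic_on_const[OF \<open>open D\<close>] intro!: superharmonic_on_add)

text \<open>
  The point reflection \<open>y \<mapsto> 2x - y\<close> preserves Lebesgue measure and the ball around \<open>x\<close>, and it
  changes the sign of \<open>(y - x) \<bullet> e\<close>, so the integral of this function over the ball vanishes.
\<close>

lemma set_integral_cball_inner_eq_0: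
  fixes x e :: "'a::euclidean_space"
  shows "(LINT y:cball x s|lborel. (y - x) \<bullet> e) = 0"
proof -
  let ?T = "\<lambda>y. 2 *\<^sub>R x + (-1) *\<^sub>R y"
  let ?f = "\<lambda>y. indicat_real (cball x s) y * ((y - x) \<bullet> e)"
  have "lborel = distr lborel borel ?T"
    using lborel_affine[of "-1" "2 *\<^sub>R x"] by (simp add: density_1)
  then have "integral\<^sup>L lborel ?f = integral\<^sup>L (distr lborel borel ?T) ?f"
    by simp
  also have "\<dots> = (\<integral>y. ?f (?T y) \<partial>lborel)"
    by (intro integral_distr borel_measurable_times borel_measurable_indicator borel_measurable_continuous_onI
        continuous_intros) auto
  also have "\<dots> = (\<integral>y. - ?f y \<partial>lborel)"
  proof (intro Bochner_Integration.integral_cong refl)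
    fix y
    have "?T y - x = - (y - x)" by (simp add: scaleR_2)
    then have "dist x (?T y) = dist x y" "(?T y - x) \<bullet> e = - ((y - x) \<bullet> e)"
      by (metis dist_norm norm_minus_cancel norm_minus_commute, metis inner_minus_left)
    then show "?f (?T y) = - ?f y" by (simp add: indicator_def)
  qed
  finally show ?thesis by (simp add: set_lebesgue_integral_def)
qed

lemma superharmonic_on_affine:
  fixes e :: "'a::euclidean_space"
  assumes "open D"
  shows "superharmonic_on D (\<lambda>x. x \<bullet> e + k)"
proof (rule superharmonic_onI)
  fix a show "open {x \<in> D. a < x \<bullet> e + k}"
    using open_Int[OF \<open>open D\<close> open_Collect_less[of "\<lambda>_. a" "\<lambda>x. x \<bullet> e + k"]]
    by (simp add: Int_def continuous_intros)
next
  fix x :: 'a and s :: real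
  have int: "set_integrable lborel (cball x s) f" if "continuous_on UNIV f" for f :: "'a \<Rightarrow> real"
    unfolding set_integrable_def
    by (intro borel_integrable_compact compact_cball continuous_on_subset[OF that]) auto
  show "set_integrable lborel (cball x s) (\<lambda>x. x \<bullet> e + k)"
    by (intro int continuous_intros)
  have "(LINT y:cball x s|lborel. y \<bullet> e + k) =
      (LINT y:cball x s|lborel. (y - x) \<bullet> e + (x \<bullet> e + k))"
    by (simp add: inner_diff_left)
  also have "\<dots> = measure lborel (cball x s) * (x \<bullet> e + k)"
    by (subst set_integral_add)
      (auto intro!: int continuous_intros simp: set_integral_cball_inner_eq_0,
        simp add: set_lebesgue_integral_def)
  finally show "(LINT y:cball x s|lborel. y \<bullet> e + k) \<le> measure lborel (cball x s) * (x \<bullet> e + k)"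
    by simp
qed

section \<open>The minimum principle\<close>

text \<open>
  At a minimum point \<open>x\<close> the mean of \<open>u - m \<ge> 0\<close> over a small ball is at most \<open>0\<close>, so
  \<open>u = m\<close> almost everywhere in this ball. Lower semicontinuity removes the exceptional null
  set: the part of the ball where \<open>u > m\<close> is open, and non-empty open sets are not null.
\<close>

lemma superharmonic_minimum_set_open:
  fixes D :: "'a::euclidean_space set"
  assumes u: "superharmonic_on D u" and "open D" and m: "\<And>x. x \<in> D \<Longrightarrow> m \<le> u x"
  shows "open {x \<in> D. u x \<le> m}"
  unfolding open_contains_ball
proof
  fix x assume "x \<in> {x \<in> D. u x \<le> m}"
  then have x: "x \<in> D" "u x \<le> m" by auto
  then obtain s where s: "0 < s" "cball x s \<subseteq> D"
    using \<open>open D\<close> open_contains_cball by blast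
  note mean = superharmonic_onD_mean[OF u s]
  note const = superharmonic_onD_mean(1)[OF superharmonic_on_const[OF \<open>open D\<close>] s]
  let ?f = "\<lambda>y. indicat_real (cball x s) y * (u y - m)"
  have int: "integrable lborel ?f"
    using set_integral_diff(1)[OF mean(1) const[of m]] by (simp add: set_integrable_def)
  have nonneg: "0 \<le> ?f y" for y
    using m s(2) by (auto simp: indicator_def)
  have "integral\<^sup>L lborel ?f = (LINT y:cball x s|lborel. u y) - (LINT y:cball x s|lborel. m)"
    using set_integral_diff(2)[OF mean(1) const[of m]] by (simp add: set_lebesgue_integral_def)
  also have "(LINT y:cball x s|lborel. m) = measure lborel (cball x s) * m"
    by (simp add: set_lebesgue_integral_def)
  also have "(LINT y:cball x s|lborel. u y) - measure lborel (cball x s) * m \<le> 0"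
    using mean(2) mult_left_mono[OF x(2), of "measure lborel (cball x s)"] by simp
  finally have "integral\<^sup>L lborel ?f = 0"
    using Bochner_Integration.integral_nonneg[of lborel ?f] nonneg by (simp add: antisym)
  then have AE: "AE y in lborel. ?f y = 0"
    using integral_nonneg_eq_0_iff_AE[OF int] nonneg by simp
  define V where "V = ball x s \<inter> {y \<in> D. m < u y}"
  have "open V"
    unfolding V_def by (intro open_Int open_ball superharmonic_onD_lsc[OF u])
  have "AE y in lborel. y \<notin> V"
    using AE by eventually_elim (auto simp: V_def indicator_def)
  then have "V \<in> null_sets lborel"
    using \<open>open V\<close> by (subst AE_iff_null_sets) auto
  then have "negligible V"
    by (simp add: negligible_iff_null_sets null_sets_completionI)
  then have "V = {}"
    using open_not_negligible[OF \<open>open V\<close>] by blast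
  then have "ball x s \<subseteq> {x \<in> D. u x \<le> m}"
    using s(2) ball_subset_cball[of x s] by (fastforce simp: V_def not_less)
  then show "\<exists>e>0. ball x e \<subseteq> {x \<in> D. u x \<le> m}"
    using s(1) by blast
qed

lemma compact_lsc_attains_min:
  fixes u :: "'a::topological_space \<Rightarrow> real"
  assumes "compact K" "K \<noteq> {}" "K \<subseteq> D" and lsc: "\<And>a. open {x \<in> D. a < u x}"
  obtains x where "x \<in> K" "\<And>y. y \<in> K \<Longrightarrow> u x \<le> u y"
proof -
  have "\<exists>x\<in>K. \<forall>y\<in>K. u x \<le> u y"
  proof (rule ccontr)
    assume "\<not> ?thesis"
    then have "K \<subseteq> (\<Union>y\<in>K. {x \<in> D. u y < u x})"
      using \<open>K \<subseteq> D\<close> by (fastforce simp: not_le)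
    then obtain F where F: "F \<subseteq> K" "finite F" "K \<subseteq> (\<Union>y\<in>F. {x \<in> D. u y < u x})"
      using compactE_image[OF \<open>compact K\<close>, of K "\<lambda>y. {x \<in> D. u y < u x}"] lsc by metis
    with \<open>K \<noteq> {}\<close> have "F \<noteq> {}" by auto
    then have "Min (u ` F) \<in> u ` F" using F(2) by (intro Min_in) auto
    then obtain y where y: "y \<in> F" "u y = Min (u ` F)" by auto
    with F obtain z where "z \<in> F" "u z < u y" by blast
    moreover from \<open>z \<in> F\<close> F(2) have "Min (u ` F) \<le> u z" by simp
    ultimately show False using y by simp
  qed
  then show thesis using that by blast
qed

text \<open>
  A negative value would make the minimum of \<open>u\<close> negative and attained, the sublevel sets
  \<open>{u \<le> a}\<close> with \<open>a < 0\<close> being compact because they stay away from the frontier. The set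
  where the minimum is attained is then compact, open by the mean value inequality and
  non-empty, which is impossible in a Euclidean space.
\<close>

lemma superharmonic_minimum_principle:
  fixes D :: "'a::euclidean_space set"
  assumes u: "superharmonic_on D u" and "open D" "bounded D"
    and bd: "\<And>z \<epsilon>. z \<in> frontier D \<Longrightarrow> 0 < \<epsilon> \<Longrightarrow> \<forall>\<^sub>F x in at z within D. - \<epsilon> < u x"
    and "x \<in> D"
  shows "0 \<le> u x"
proof (rule ccontr)
  assume "\<not> 0 \<le> u x"
  then have neg: "u x < 0" by simp
  have cpt: "compact {y \<in> D. u y \<le> a}" if "a < 0" for a
  proof -
    have "closed {y \<in> D. u y \<le> a}"
      unfolding closed_def open_subopen[of "- _"]
    proof
      fix z assume "z \<in> - {y \<in> D. u y \<le> a}"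
      then consider "z \<in> D" "a < u z" | "z \<in> frontier D" | "z \<notin> closure D"
        using \<open>open D\<close> by (auto simp: frontier_def interior_open not_le)
      then show "\<exists>T. open T \<and> z \<in> T \<and> T \<subseteq> - {y \<in> D. u y \<le> a}"
      proof cases
        case 1
        then show ?thesis
          using superharmonic_onD_lsc[OF u, of a] by (intro exI[of _ "{y \<in> D. a < u y}"]) auto
      next
        case 2
        then have "z \<notin> D" using \<open>open D\<close> by (simp add: frontier_def interior_open)
        moreover obtain T where "open T" "z \<in> T" "\<forall>y\<in>T. y \<noteq> z \<longrightarrow> y \<in> D \<longrightarrow> a < u y"
          using bd[OF 2, of "- a"] \<open>a < 0\<close> by (auto simp: eventually_at_topological)
        ultimately show ?thesis by (intro exI[of _ T]) force
      next
        case 3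
        then show ?thesis
          using closure_subset[of D] by (intro exI[of _ "- closure D"]) auto
      qed
    qed
    moreover have "bounded {y \<in> D. u y \<le> a}"
      using \<open>bounded D\<close> by (rule bounded_subset) auto
    ultimately show ?thesis by (simp add: compact_eq_bounded_closed)
  qed
  obtain p where p: "p \<in> D" "u p \<le> u x" "\<And>y. y \<in> D \<Longrightarrow> u y \<le> u x \<Longrightarrow> u p \<le> u y"
  proof (rule compact_lsc_attains_min[OF cpt[OF neg] _ _ superharmonic_onD_lsc[OF u]])
    show "{y \<in> D. u y \<le> u x} \<noteq> {}" using \<open>x \<in> D\<close> by auto
  qed auto
  let ?A = "{y \<in> D. u y \<le> u p}"
  have "u p \<le> u y" if "y \<in> D" for y
    using p that by (cases "u y \<le> u x") auto
  then have "open ?A"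
    by (rule superharmonic_minimum_set_open[OF u \<open>open D\<close>])
  moreover have "compact ?A"
    using p neg by (intro cpt) auto
  ultimately show False
    using p compact_open[of ?A] by auto
qed

section \<open>Harmonic measure and subharmonic functions\<close>

lemma perron_upper_class_eventually:
  assumes "u \<in> perron_upper_class D f" "z \<in> frontier D" "0 < \<epsilon>"
  shows "\<forall>\<^sub>F x in at z within D. f z - \<epsilon> < u x"
proof -
  have "ereal (f z) \<le> Liminf (at z within D) (\<lambda>x. ereal (u x))"
    using assms by (simp add: perron_upper_class_def)
  moreover have "ereal (f z - \<epsilon>) < ereal (f z)" using \<open>0 < \<epsilon>\<close> by simp
  ultimately have "\<forall>\<^sub>F x in at z within D. ereal (f z - \<epsilon>) < ereal (u x)"
    unfolding le_Liminf_iff by blast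
  then show ?thesis by simp
qed

text \<open>
  The infimum in a Perron solution is approached by values of upper functions only if upper
  functions exist; for the empty set the real infimum would be an arbitrary default.
\<close>

lemma one_in_perron_upper_class:
  "open D \<Longrightarrow> (\<lambda>_. 1) \<in> perron_upper_class D (indicat_real E)"
  unfolding perron_upper_class_def
  by (auto simp: superharmonic_on_const le_Liminf_iff indicator_def
      intro!: always_eventually intro: less_le_trans)

text \<open>
  Upper Perron solutions are subadditive in the boundary data, because a non-negative
  combination of upper functions is an upper function of the combined data; and by the minimum
  principle every upper function of data dominating \<open>h\<close> lies above \<open>h\<close>. The infimum for each
  \<open>E i\<close> is approached only up to some \<open>\<delta>\<close>, chosen so that the errors add up to at most \<open>\<epsilon>\<close>.
\<close>

lemma subharmonic_le_sum_harmonic_measure: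
  fixes D :: "'a::euclidean_space set"
  assumes "open D" "bounded D" "\<theta> \<in> D"
    and sub: "superharmonic_on D (\<lambda>x. - h x)" and cont: "continuous_on (closure D) h"
    and "finite I" and a: "\<And>i. i \<in> I \<Longrightarrow> 0 \<le> a i"
    and le: "\<And>z. z \<in> frontier D \<Longrightarrow> h z \<le> (\<Sum>i\<in>I. a i * indicator (E i) z)"
  shows "h \<theta> \<le> (\<Sum>i\<in>I. a i * harmonic_measure \<theta> (E i) D)"
proof (rule field_le_epsilon)
  fix \<epsilon> :: real assume "0 < \<epsilon>"
  \<comment> \<open>The summand \<open>1\<close> allows dividing by \<open>C\<close> even if all coefficients vanish.\<close>
  define C where "C = (\<Sum>i\<in>I. a i) + 1"
  have C: "0 < C" "(\<Sum>i\<in>I. a i) < C" using sum_nonneg[of I a] a by (auto simp: C_def)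
  define \<delta> where "\<delta> = \<epsilon> / C"
  have "0 < \<delta>" using C \<open>0 < \<epsilon>\<close> by (simp add: \<delta>_def)
  have "\<exists>v. v \<in> perron_upper_class D (indicat_real (E i)) \<and> v \<theta> < harmonic_measure \<theta> (E i) D + \<delta>"
    for i
  proof -
    have "(\<lambda>v. v \<theta>) ` perron_upper_class D (indicat_real (E i)) \<noteq> {}"
      using one_in_perron_upper_class[OF \<open>open D\<close>] by blast
    from cInf_lessD[OF this, of "harmonic_measure \<theta> (E i) D + \<delta>"] show ?thesis
      using \<open>0 < \<delta>\<close> unfolding harmonic_measure_def harmonic_extension_def by auto
  qed
  then obtain v where v: "\<And>i. v i \<in> perron_upper_class D (indicat_real (E i))"
    and v\<theta>: "\<And>i. v i \<theta> < harmonic_measure \<theta> (E i) D + \<delta>"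
    by metis
  have "0 \<le> (\<Sum>i\<in>I. a i * v i \<theta>) + - h \<theta>"
  proof (rule superharmonic_minimum_principle[OF _ \<open>open D\<close> \<open>bounded D\<close> _ \<open>\<theta> \<in> D\<close>])
    show "superharmonic_on D (\<lambda>x. (\<Sum>i\<in>I. a i * v i x) + - h x)"
      using v a sub \<open>open D\<close>
      by (intro superharmonic_on_add superharmonic_on_sum superharmonic_on_cmult)
        (auto simp: perron_upper_class_def)
  next
    fix z and \<epsilon>' :: real assume z: "z \<in> frontier D" and "0 < \<epsilon>'"
    \<comment> \<open>Half of \<open>\<epsilon>'\<close> pays for the upper functions \<open>v i\<close>, the other half for the continuity of \<open>h\<close>.\<close>
    define \<delta>' where "\<delta>' = \<epsilon>' / (2 * C)"
    have "0 < \<delta>'" "\<delta>' * C = \<epsilon>' / 2" using C \<open>0 < \<epsilon>'\<close> by (auto simp: \<delta>'_def)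
    have "\<forall>\<^sub>F x in at z within D. \<forall>i\<in>I. indicator (E i) z - \<delta>' < v i x"
      using perron_upper_class_eventually[OF v z \<open>0 < \<delta>'\<close>] \<open>finite I\<close>
      by (simp add: eventually_ball_finite)
    moreover have "\<forall>\<^sub>F x in at z within D. h x < h z + \<epsilon>' / 2"
    proof -
      have "z \<in> closure D" using z by (simp add: frontier_def)
      then have "(h \<longlongrightarrow> h z) (at z within D)"
        using cont closure_subset by (auto simp: continuous_on_def intro: tendsto_within_subset)
      then show ?thesis using \<open>0 < \<epsilon>'\<close> by (intro order_tendstoD) auto
    qed
    ultimately show "\<forall>\<^sub>F x in at z within D. - \<epsilon>' < (\<Sum>i\<in>I. a i * v i x) + - h x"
    proof eventually_elim
      case (elim x)
      have "(\<Sum>i\<in>I. a i * (indicator (E i) z - \<delta>')) \<le> (\<Sum>i\<in>I. a i * v i x)"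
        using elim(1) a by (intro sum_mono mult_left_mono) (auto intro: less_imp_le)
      moreover have "(\<Sum>i\<in>I. a i * (indicator (E i) z - \<delta>')) =
          (\<Sum>i\<in>I. a i * indicator (E i) z) - \<delta>' * (\<Sum>i\<in>I. a i)"
        by (simp add: right_diff_distrib sum_subtractf sum_distrib_left mult.commute)
      moreover have "\<delta>' * (\<Sum>i\<in>I. a i) \<le> \<epsilon>' / 2"
        using mult_left_mono[of "\<Sum>i\<in>I. a i" C \<delta>'] C \<open>0 < \<delta>'\<close> \<open>\<delta>' * C = \<epsilon>' / 2\<close> by simp
      ultimately show ?case using le[OF z] elim(2) by linarith
    qed
  qed
  then have "h \<theta> \<le> (\<Sum>i\<in>I. a i * v i \<theta>)" by simp
  also have "\<dots> \<le> (\<Sum>i\<in>I. a i * (harmonic_measure \<theta> (E i) D + \<delta>))"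
    using v\<theta> a by (intro sum_mono mult_left_mono) (auto intro: less_imp_le)
  also have "\<dots> = (\<Sum>i\<in>I. a i * harmonic_measure \<theta> (E i) D) + \<delta> * (\<Sum>i\<in>I. a i)"
    by (simp add: distrib_left sum.distrib sum_distrib_left mult.commute)
  also have "\<delta> * (\<Sum>i\<in>I. a i) \<le> \<epsilon>"
    using mult_left_mono[of "\<Sum>i\<in>I. a i" C \<delta>] C \<open>0 < \<delta>\<close> by (simp add: \<delta>_def)
  finally show "h \<theta> \<le> (\<Sum>i\<in>I. a i * harmonic_measure \<theta> (E i) D) + \<epsilon>" by simp
qed

lemma harmonic_distributed_integrable:
  fixes Y :: "'w \<Rightarrow> 'a::euclidean_space" and h :: "'a \<Rightarrow> real"
  assumes "prob_space M" "bounded D" "harmonic_distributed M Y \<theta> D"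
    and cont: "continuous_on (frontier D) h"
  shows "integrable M (\<lambda>w. h (Y w))"
proof -
  interpret prob_space M by fact
  have [measurable]: "Y \<in> borel_measurable M" and Y: "\<And>w. w \<in> space M \<Longrightarrow> Y w \<in> frontier D"
    using assms by (auto simp: harmonic_distributed_def)
  have "(\<lambda>z. indicator (frontier D) z *\<^sub>R h z) \<in> borel_measurable borel"
    by (intro borel_measurable_continuous_on_indicator cont) auto
  from measurable_compose[OF \<open>Y \<in> borel_measurable M\<close> this]
  have "(\<lambda>w. indicator (frontier D) (Y w) *\<^sub>R h (Y w)) \<in> borel_measurable M" .
  then have meas: "(\<lambda>w. h (Y w)) \<in> borel_measurable M"
    by (rule measurable_cong[THEN iffD1, rotated]) (simp add: Y)
  have "bounded (h ` frontier D)"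
    using cont \<open>bounded D\<close>
    by (intro compact_imp_bounded compact_continuous_image) (auto simp: compact_frontier_bounded)
  then obtain B where "\<And>z. z \<in> frontier D \<Longrightarrow> norm (h z) \<le> B"
    by (auto simp: bounded_iff)
  then show ?thesis
    using meas Y by (intro integrable_const_bound[where B = B]) auto
qed

text \<open>
  Round \<open>h\<close> up to the next multiple of \<open>\<eta>\<close>: the level sets of the rounded function are
  finitely many Borel subsets of the frontier, whose harmonic measures are probabilities of \<open>Y\<close>.
  As \<open>h\<close> is non-negative, so are these multiples, which are the coefficients of a step function
  above \<open>h\<close> and have to preserve superharmonicity.
\<close>

lemma subharmonic_le_expectation:
  fixes D :: "'a::euclidean_space set"
  assumes "prob_space M" "open D" "bounded D" "\<theta> \<in> D" "harmonic_distributed M Y \<theta> D"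
    and sub: "superharmonic_on D (\<lambda>x. - h x)" and cont: "continuous_on (closure D) h"
    and nonneg: "\<And>z. z \<in> frontier D \<Longrightarrow> 0 \<le> h z"
  shows "h \<theta> \<le> (\<integral>w. h (Y w) \<partial>M)"
proof (rule field_le_epsilon)
  fix \<eta> :: real assume "0 < \<eta>"
  interpret prob_space M by fact
  have [measurable]: "Y \<in> borel_measurable M" and Y: "\<And>w. w \<in> space M \<Longrightarrow> Y w \<in> frontier D"
    and prob: "\<And>E. E \<in> sets borel \<Longrightarrow> E \<subseteq> frontier D \<Longrightarrow>
      prob {w \<in> space M. Y w \<in> E} = harmonic_measure \<theta> E D"
    using \<open>harmonic_distributed M Y \<theta> D\<close> by (auto simp: harmonic_distributed_def)
  have contf: "continuous_on (frontier D) h"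
    using cont by (rule continuous_on_subset) (auto simp: frontier_def)
  \<comment> \<open>Cutting \<open>h\<close> off outside the frontier makes \<open>n\<close> Borel measurable on the whole space.\<close>
  define n where "n z = nat \<lfloor>(indicator (frontier D) z *\<^sub>R h z) / \<eta>\<rfloor>" for z
  define E where "E k = {z \<in> frontier D. n z = k}" for k
  have [measurable]: "(\<lambda>z. indicator (frontier D) z *\<^sub>R h z) \<in> borel_measurable borel"
    by (intro borel_measurable_continuous_on_indicator contf) auto
  have [measurable]: "n \<in> borel \<rightarrow>\<^sub>M count_space UNIV"
    unfolding n_def by measurable
  have [measurable]: "frontier D \<in> sets borel" by auto
  have E [measurable]: "E k \<in> sets borel" for k
    unfolding E_def by measurable
  have n: "h z \<le> \<eta> * (real (n z) + 1)" "\<eta> * (real (n z) + 1) \<le> h z + \<eta>" if "z \<in> frontier D" for z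
  proof -
    have eq: "real (n z) = of_int \<lfloor>h z / \<eta>\<rfloor>"
      using that nonneg[OF that] \<open>0 < \<eta>\<close> by (simp add: n_def)
    have "h z / \<eta> \<le> real (n z) + 1" "real (n z) \<le> h z / \<eta>" unfolding eq by linarith+
    then show "h z \<le> \<eta> * (real (n z) + 1)" "\<eta> * (real (n z) + 1) \<le> h z + \<eta>"
      using \<open>0 < \<eta>\<close> by (auto simp: field_simps)
  qed
  obtain N where N: "\<And>z. z \<in> frontier D \<Longrightarrow> n z \<le> N"
  proof -
    have "bounded (h ` frontier D)"
      using contf \<open>bounded D\<close>
      by (intro compact_imp_bounded compact_continuous_image) (auto simp: compact_frontier_bounded)
    then obtain B where B: "\<And>z. z \<in> frontier D \<Longrightarrow> h z \<le> B"
      by (auto simp: bounded_iff intro: abs_le_D1)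
    have "n z \<le> nat \<lfloor>B / \<eta>\<rfloor>" if "z \<in> frontier D" for z
      using that B[OF that] \<open>0 < \<eta>\<close>
      by (auto simp: n_def intro!: nat_mono floor_mono divide_right_mono)
    then show thesis using that by blast
  qed
  have step: "(\<Sum>k\<le>N. \<eta> * (real k + 1) * indicator (E k) z) = \<eta> * (real (n z) + 1)"
    if "z \<in> frontier D" for z
  proof -
    have "(\<Sum>k\<le>N. \<eta> * (real k + 1) * indicator (E k) z) =
        (\<Sum>k\<le>N. if n z = k then \<eta> * (real k + 1) else 0)"
      using that by (intro sum.cong) (auto simp: E_def)
    then show ?thesis using N[OF that] by simp
  qed
  have "h \<theta> \<le> (\<Sum>k\<le>N. \<eta> * (real k + 1) * harmonic_measure \<theta> (E k) D)"
    using step n \<open>0 < \<eta>\<close>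
    by (intro subharmonic_le_sum_harmonic_measure[OF \<open>open D\<close> \<open>bounded D\<close> \<open>\<theta> \<in> D\<close> sub cont]) auto
  also have "\<dots> = (\<Sum>k\<le>N. \<integral>w. \<eta> * (real k + 1) * indicator (E k) (Y w) \<partial>M)"
  proof (intro sum.cong refl)
    fix k
    have "(\<integral>w. indicator (E k) (Y w) \<partial>M) = (\<integral>w. indicat_real {w \<in> space M. Y w \<in> E k} w \<partial>M)"
      by (intro Bochner_Integration.integral_cong) (auto simp: indicator_def)
    also have "\<dots> = harmonic_measure \<theta> (E k) D"
      using prob[OF E, of k]
      by (subst Bochner_Integration.integral_indicator)
        (auto simp: E_def Int_absorb2 intro!: arg_cong[where f = prob])
    finally show "\<eta> * (real k + 1) * harmonic_measure \<theta> (E k) D =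
        (\<integral>w. \<eta> * (real k + 1) * indicator (E k) (Y w) \<partial>M)" by simp
  qed
  also have "\<dots> = (\<integral>w. (\<Sum>k\<le>N. \<eta> * (real k + 1) * indicator (E k) (Y w)) \<partial>M)"
    by (intro Bochner_Integration.integral_sum[symmetric] integrable_mult_right
        integrable_const_bound[where B = 1]) auto
  also have "\<dots> \<le> (\<integral>w. h (Y w) + \<eta> \<partial>M)"
  proof (rule integral_mono)
    show "integrable M (\<lambda>w. \<Sum>k\<le>N. \<eta> * (real k + 1) * indicator (E k) (Y w))"
      by (intro Bochner_Integration.integrable_sum integrable_mult_right
          integrable_const_bound[where B = 1]) auto
    show "integrable M (\<lambda>w. h (Y w) + \<eta>)"
      using harmonic_distributed_integrable[OF assms(1,3,5) contf] by simp
  qed (use step n Y in auto)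
  also have "\<dots> = (\<integral>w. h (Y w) \<partial>M) + \<eta>"
    using harmonic_distributed_integrable[OF assms(1,3,5) contf] by (simp add: prob_space)
  finally show "h \<theta> \<le> (\<integral>w. h (Y w) \<partial>M) + \<eta>" .
qed

text \<open>
  An affine function and its negative are both superharmonic, so the inequality for
  subharmonic functions applies to \<open>e\<close> and \<open>- e\<close>. The shift by \<open>K\<close> only serves to make the
  function non-negative on the frontier, and it cancels because \<open>M\<close> has total mass \<open>1\<close>.
\<close>

lemma harmonic_distributed_expectation_inner:
  fixes D :: "'a::euclidean_space set"
  assumes "prob_space M" "open D" "bounded D" "\<theta> \<in> D" "harmonic_distributed M Y \<theta> D"
  shows "(\<integral>w. Y w \<bullet> e \<partial>M) = \<theta> \<bullet> e"
proof -
  interpret prob_space M by fact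
  have le: "\<theta> \<bullet> e \<le> (\<integral>w. Y w \<bullet> e \<partial>M)" for e
  proof -
    have "bounded (frontier D)" using \<open>bounded D\<close> compact_frontier_bounded compact_imp_bounded by blast
    then obtain B where B: "\<And>z. z \<in> frontier D \<Longrightarrow> norm z \<le> B"
      by (auto simp: bounded_iff)
    define K where "K = B * norm e"
    have K: "0 \<le> z \<bullet> e + K" if "z \<in> frontier D" for z
    proof -
      have "\<bar>z \<bullet> e\<bar> \<le> norm z * norm e" by (rule Cauchy_Schwarz_ineq2)
      also have "\<dots> \<le> K" unfolding K_def by (intro mult_right_mono B that) auto
      finally show ?thesis by linarith
    qed
    have "superharmonic_on D (\<lambda>x. - (x \<bullet> e + K))"
      using superharmonic_on_affine[OF \<open>open D\<close>, of "- e" "- K"] by simp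
    from subharmonic_le_expectation[OF assms this _ K]
    have "\<theta> \<bullet> e + K \<le> (\<integral>w. Y w \<bullet> e + K \<partial>M)"
      by (simp add: continuous_intros)
    also have "\<dots> = (\<integral>w. Y w \<bullet> e \<partial>M) + K"
      using harmonic_distributed_integrable[OF assms(1,3,5), of "\<lambda>z. z \<bullet> e"]
      by (simp add: prob_space continuous_intros)
    finally show ?thesis by simp
  qed
  show ?thesis
    using le[of e] le[of "- e"] by simp
qed

section \<open>The covariance of harmonic measure on a sphere\<close>

theorem lemma2:
  fixes M :: "'w measure" and Y :: "'w \<Rightarrow> real ^ 'n"
    and c \<theta> :: "real ^ 'n" and r :: real
  assumes "prob_space M"
    and "r > 0"
    and "\<theta> \<in> ball c r"
    and "harmonic_distributed M Y \<theta> (ball c r)"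
  shows "trace (covariance_matrix M Y) = r\<^sup>2 - (norm (\<theta> - c))\<^sup>2"
proof -
  interpret prob_space M by fact
  have sphere: "norm (Y w - c) = r" if "w \<in> space M" for w
    using assms that by (auto simp: harmonic_distributed_def dist_norm norm_minus_commute)
  have int: "integrable M (\<lambda>w. f (Y w))" if "continuous_on UNIV f" for f :: "real ^ 'n \<Rightarrow> real"
    by (rule harmonic_distributed_integrable[OF assms(1) bounded_ball assms(4)])
      (use that in \<open>auto intro: continuous_on_subset\<close>)
  have int1: "integrable M (\<lambda>w. Y w $ i)" for i
    by (intro int continuous_intros)
  have int2: "integrable M (\<lambda>w. (Y w $ i - c $ i)\<^sup>2)" for i
    by (intro int continuous_intros)
  have mean: "(\<integral>w. Y w $ i \<partial>M) = \<theta> $ i" for i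
    using harmonic_distributed_expectation_inner[OF assms(1) open_ball bounded_ball assms(3,4),
        of "axis i 1"]
    by (simp add: inner_axis)
  \<comment> \<open>The variance of a coordinate, with the second moment taken about the centre of the ball\<close>
  have cov: "covariance M (\<lambda>w. Y w $ i) (\<lambda>w. Y w $ i) =
      (\<integral>w. (Y w $ i - c $ i)\<^sup>2 \<partial>M) - (\<theta> $ i - c $ i)\<^sup>2" for i
  proof -
    have "covariance M (\<lambda>w. Y w $ i) (\<lambda>w. Y w $ i) =
        (\<integral>w. (Y w $ i - c $ i)\<^sup>2 - (2 * (\<theta> $ i - c $ i) * Y w $ i
          - ((\<theta> $ i)\<^sup>2 - (c $ i)\<^sup>2)) \<partial>M)"
      unfolding covariance_def mean
      by (intro Bochner_Integration.integral_cong refl) (simp add: power2_eq_square algebra_simps)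
    also have "\<dots> = (\<integral>w. (Y w $ i - c $ i)\<^sup>2 \<partial>M)
        - (2 * (\<theta> $ i - c $ i) * \<theta> $ i - ((\<theta> $ i)\<^sup>2 - (c $ i)\<^sup>2))"
      using int1[of i] int2[of i] by (simp add: mean prob_space)
    also have "\<dots> = (\<integral>w. (Y w $ i - c $ i)\<^sup>2 \<partial>M) - (\<theta> $ i - c $ i)\<^sup>2"
      by (simp add: power2_eq_square algebra_simps)
    finally show ?thesis .
  qed
  have norm_sq: "(norm x)\<^sup>2 = (\<Sum>i\<in>UNIV. (x $ i)\<^sup>2)" for x :: "real ^ 'n"
    by (simp add: norm_vec_def L2_set_def sum_nonneg)
  have "trace (covariance_matrix M Y) =
      (\<Sum>i\<in>UNIV. (\<integral>w. (Y w $ i - c $ i)\<^sup>2 \<partial>M) - (\<theta> $ i - c $ i)\<^sup>2)"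
    by (simp add: trace_def covariance_matrix_def cov)
  also have "\<dots> = (\<integral>w. (\<Sum>i\<in>UNIV. (Y w $ i - c $ i)\<^sup>2) \<partial>M) - (norm (\<theta> - c))\<^sup>2"
    using int2 by (simp add: sum_subtractf norm_sq)
  also have "(\<integral>w. (\<Sum>i\<in>UNIV. (Y w $ i - c $ i)\<^sup>2) \<partial>M) = (\<integral>w. r\<^sup>2 \<partial>M)"
    using sphere norm_sq[of "Y _ - c"]
    by (intro Bochner_Integration.integral_cong) (auto simp flip: sphere)
  also have "\<dots> = r\<^sup>2" by (simp add: prob_space)
  finally show ?thesis .
qed

end
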